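(* The following inequalities are equivalent, i.e. each of the following (universally quantified) assertions can be deduced from any other: (i) (Bernoulli inequality) for all real $x\ge -1$ and real $\alpha\ge 1$, $(1+x)^{\alpha}\ge 1+\alpha x$; (ii) (weighted AM-GM inequality) for every $n\ge1$, all nonnegative reals $x_1,\ldots,x_n$ and all positive reals $\lambda_1,\ldots,\lambda_n$ with $\sum_{k=1}^n\lambda_k=1$, $\sum_{k=1}^n\lambda_kx_k\ge\prod_{k=1}^n x_k^{\lambda_k}$; (iii) (H\"older inequality) for every $n\ge1$, all nonnegative reals $a_1,\ldots,a_n,b_1,\ldots,b_n$ and all reals $p,q>1$ with $\frac1p+\frac1q=1$, $\sum_{k=1}^n a_kb_k\le\left(\sum_{k=1}^n a_k^p\right)^{1/p}\left(\sum_{k=1}^n b_k^q\right)^{1/q}$; (iv) (weighted power mean inequality) for every $n\ge1$, all nonnegative reals $x_1,\ldots,x_n$, all positive reals $p_1,\ldots,p_n$ and all real $r\ge s>0$, $\left(\frac{\sum_{k=1}^n p_kx_k^r}{\sum_{k=1}^n p_k}\right)^{1/r}\ge\left(\frac{\sum_{k=1}^n p_kx_k^s}{\sum_{k=1}^n p_k}\right)^{1/s}$; (v) (Minkowski inequality) for every $n\ge1$, all nonnegative reals $a_1,\ldots,a_n,b_1,\ldots,b_n$ and every real $p\ge1$, $\left(\sum_{k=1}^n(a_k+b_k)^p\right)^{1/p}\le\left(\sum_{k=1}^n a_k^p\right)^{1/p}+\left(\sum_{k=1}^n b_k^p\right)^{1/p}$; (vi) (Radon inequality) for every $n\ge1$,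 all positive reals $b_1,\ldots,b_n$, all nonnegative reals $a_1,\ldots,a_n$ and every real $m\ge0$, $\sum_{k=1}^n\frac{a_k^{m+1}}{b_k^m}\ge\frac{\left(\sum_{k=1}^n a_k\right)^{m+1}}{\left(\sum_{k=1}^n b_k\right)^m}$.
   Context: "Equivalent" means that each inequality, assumed for all admissible values of its variables, implies each of the others for all admissible values of their variables. Powers are real powers of nonnegative real numbers. *)

theory Defs
  imports Complex_Main
begin

text \<open>
  Real powers of nonnegative reals are rendered by \<open>powr\<close>. The convention \<open>0 powr 0 = 0\<close>
  is never met below: whenever the exponent can be zero, the base is positive.
  A finite family \<open>x\<^sub>1, \<dots>, x\<^sub>n\<close> is a function on \<open>nat\<close> of which only the values on
  \<open>{1..n}\<close> matter.
\<close>

definition bernoulli_inequality :: bool where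
  "bernoulli_inequality \<longleftrightarrow>
    (\<forall>(x::real) (\<alpha>::real). x \<ge> -1 \<longrightarrow> \<alpha> \<ge> 1 \<longrightarrow> (1 + x) powr \<alpha> \<ge> 1 + \<alpha> * x)"

definition weighted_AM_GM_inequality :: bool where
  "weighted_AM_GM_inequality \<longleftrightarrow>
    (\<forall>(n::nat) (x::nat \<Rightarrow> real) (l::nat \<Rightarrow> real).
      n \<ge> 1 \<longrightarrow> (\<forall>k\<in>{1..n}. x k \<ge> 0) \<longrightarrow> (\<forall>k\<in>{1..n}. l k > 0) \<longrightarrow> (\<Sum>k=1..n. l k) = 1 \<longrightarrow>
      (\<Sum>k=1..n. l k * x k) \<ge> (\<Prod>k=1..n. x k powr l k))"

definition hoelder_inequality :: bool where
  "hoelder_inequality \<longleftrightarrow>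
    (\<forall>(n::nat) (a::nat \<Rightarrow> real) (b::nat \<Rightarrow> real) (p::real) (q::real).
      n \<ge> 1 \<longrightarrow> (\<forall>k\<in>{1..n}. a k \<ge> 0) \<longrightarrow> (\<forall>k\<in>{1..n}. b k \<ge> 0) \<longrightarrow>
      p > 1 \<longrightarrow> q > 1 \<longrightarrow> 1 / p + 1 / q = 1 \<longrightarrow>
      (\<Sum>k=1..n. a k * b k)
        \<le> (\<Sum>k=1..n. a k powr p) powr (1 / p) * (\<Sum>k=1..n. b k powr q) powr (1 / q))"

definition weighted_power_mean_inequality :: bool where
  "weighted_power_mean_inequality \<longleftrightarrow>
    (\<forall>(n::nat) (x::nat \<Rightarrow> real) (p::nat \<Rightarrow> real) (r::real) (s::real).
      n \<ge> 1 \<longrightarrow> (\<forall>k\<in>{1..n}. x k \<ge> 0) \<longrightarrow> (\<forall>k\<in>{1..n}. p k > 0) \<longrightarrow> r \<ge> s \<longrightarrow> s > 0 \<longrightarrow>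
      ((\<Sum>k=1..n. p k * x k powr r) / (\<Sum>k=1..n. p k)) powr (1 / r)
        \<ge> ((\<Sum>k=1..n. p k * x k powr s) / (\<Sum>k=1..n. p k)) powr (1 / s))"

definition minkowski_inequality :: bool where
  "minkowski_inequality \<longleftrightarrow>
    (\<forall>(n::nat) (a::nat \<Rightarrow> real) (b::nat \<Rightarrow> real) (p::real).
      n \<ge> 1 \<longrightarrow> (\<forall>k\<in>{1..n}. a k \<ge> 0) \<longrightarrow> (\<forall>k\<in>{1..n}. b k \<ge> 0) \<longrightarrow> p \<ge> 1 \<longrightarrow>
      (\<Sum>k=1..n. (a k + b k) powr p) powr (1 / p)
        \<le> (\<Sum>k=1..n. a k powr p) powr (1 / p) + (\<Sum>k=1..n. b k powr p) powr (1 / p))"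

definition radon_inequality :: bool where
  "radon_inequality \<longleftrightarrow>
    (\<forall>(n::nat) (a::nat \<Rightarrow> real) (b::nat \<Rightarrow> real) (m::real).
      n \<ge> 1 \<longrightarrow> (\<forall>k\<in>{1..n}. b k > 0) \<longrightarrow> (\<forall>k\<in>{1..n}. a k \<ge> 0) \<longrightarrow> m \<ge> 0 \<longrightarrow>
      (\<Sum>k=1..n. a k powr (m + 1) / b k powr m)
        \<ge> (\<Sum>k=1..n. a k) powr (m + 1) / (\<Sum>k=1..n. b k) powr m)"

definition equivalent_assertions :: "bool list \<Rightarrow> bool" where
  "equivalent_assertions Ps \<longleftrightarrow> (\<forall>i<length Ps. \<forall>j<length Ps. Ps ! i \<longrightarrow> Ps ! j)"

end

theory Submission
  imports Defs
begin

text \<open>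
  Bernoulli's inequality says that a power \<open>t \<mapsto> t\<^sup>\<alpha>\<close> with \<open>\<alpha> \<ge> 1\<close> lies above its tangent at
  \<open>1\<close>. The other five are consequences of the convexity of powers, and each of them contains
  enough of this convexity to give the tangent back. The equivalence is obtained from two
  cycles of implications, in which each inequality is deduced from the preceding one.

  Bernoulli \<open>\<Longrightarrow>\<close> AM-GM \<open>\<Longrightarrow>\<close> Hoelder \<open>\<Longrightarrow>\<close> Minkowski: Bernoulli for \<open>1 + x = (u / v)\<^sup>s\<close>
  and the exponent \<open>1 / s\<close> is the AM-GM inequality with two terms, and induction gives \<open>n\<close> terms. Two terms suffice for
  Hoelder, by normalising both sums to \<open>1\<close>. Minkowski follows from Hoelder applied to both parts
  of \<open>(a + b)\<^sup>p = a (a + b)\<^sup>p\<^sup>-\<^sup>1 + b (a + b)\<^sup>p\<^sup>-\<^sup>1\<close>.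

  Bernoulli \<open>\<Longrightarrow>\<close> Radon \<open>\<Longrightarrow>\<close> power means: the tangent bound, used for each summand on the left of
  Radon's inequality at the common ratio \<open>(\<Sum>a) / (\<Sum>b)\<close>, sums to the right-hand side. The
  power mean inequality is Radon's with \<open>m = r / s - 1\<close>, \<open>a\<^sub>k = p\<^sub>k x\<^sub>k\<^sup>s\<close>, \<open>b\<^sub>k = p\<^sub>k\<close>.

  Both cycles are closed through the convexity inequality
  \<open>((1 - t) + t c)\<^sup>p \<le> (1 - t) + t c\<^sup>p\<close> on \<open>0 < t < 1\<close>: its two sides agree at \<open>t = 0\<close>, and comparing
  their derivatives there, for \<open>c = 1 + x\<close>, is Bernoulli (\<open>powr_convex_imp_bernoulli\<close>). Power means with two
  terms and exponents \<open>p, 1\<close> give the convexity inequality at once. From Minkowski it arises as the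
  first-order term in \<open>d\<close> of the convexity of \<open>c \<mapsto> (1 + d c\<^sup>p)\<^sup>1\<^sup>/\<^sup>p\<close>
  (\<open>minkowski_imp_bernoulli\<close>).
\<close>

section \<open>From Bernoulli to Minkowski\<close>

text \<open>The case \<open>n = 2\<close> of the weighted AM-GM inequality.\<close>

lemma bernoulli_imp_young:
  fixes u v s :: real
  assumes bernoulli_inequality
    and u: "u \<ge> 0" and v: "v \<ge> 0" and s: "0 < s" "s < 1"
  shows "u powr s * v powr (1 - s) \<le> s * u + (1 - s) * v"
proof (cases "v = 0")
  case True
  then show ?thesis using u s by simp
next
  case False
  then have v: "v > 0" using v by simp
  define z where "z = u / v"
  have z: "z \<ge> 0" using u v by (simp add: z_def)
  have "(1 + (z powr s - 1)) powr (1 / s) \<ge> 1 + (1 / s) * (z powr s - 1)"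
    using s
    by (intro assms(1)[unfolded bernoulli_inequality_def, rule_format]) simp_all
  then have "z \<ge> 1 + (1 / s) * (z powr s - 1)"
    using z s by (simp add: powr_powr)
  then have "s * z \<ge> s * (1 + (1 / s) * (z powr s - 1))"
    using s by simp
  also have "s * (1 + (1 / s) * (z powr s - 1)) = s + z powr s - 1"
    using s by (simp add: field_simps)
  finally have "z powr s \<le> s * z + (1 - s)" by simp
  then have "v * z powr s \<le> v * (s * z + (1 - s))"
    using v by simp
  moreover have "v * (s * z + (1 - s)) = s * u + (1 - s) * v"
    using v by (simp add: z_def field_simps)
  moreover have "v * z powr s = u powr s * v powr (1 - s)"
    using u v by (simp add: z_def powr_divide powr_diff)
  ultimately show ?thesis by simp
qed

lemma bernoulli_imp_AM_GM:
  assumes B: bernoulli_inequality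
  shows weighted_AM_GM_inequality
proof -
  have "(\<Prod>k=1..n. x k powr l k) \<le> (\<Sum>k=1..n. l k * x k)"
    if "n \<ge> 1" "\<forall>k\<in>{1..n}. x k \<ge> 0" "\<forall>k\<in>{1..n}. l k > 0" "(\<Sum>k=1..n. l k) = 1"
    for n and x l :: "nat \<Rightarrow> real"
    using that
  proof (induction n arbitrary: l rule: dec_induct)
    case base
    then show ?case by simp
  next
    case (step n)
    define m where "m = l (Suc n)"
    have n: "{1..Suc n} = insert (Suc n) {1..n}" "{1..n} \<noteq> {}"
      using step by auto
    have pos: "(\<Sum>k=1..n. l k) > 0"
      using step.prems n by (intro sum_pos) auto
    have m: "(\<Sum>k=1..n. l k) = 1 - m"
      using step.prems by (simp add: m_def)
    have m1: "0 < m" "m < 1" using pos m step.prems by (auto simp: m_def)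
    define l' where "l' k = l k / (1 - m)" for k
    have l: "l k = l' k * (1 - m)" for k using m1 by (simp add: l'_def)
    have tail: "(1 - m) * (\<Sum>k=1..n. l' k * x k) = (\<Sum>k=1..n. l k * x k)"
      by (simp add: l sum_distrib_left ac_simps)
    have IH: "(\<Prod>k=1..n. x k powr l' k) \<le> (\<Sum>k=1..n. l' k * x k)"
      using step.prems m m1
      by (intro step.IH) (auto simp: l'_def simp flip: sum_divide_distrib)
    have "(\<Prod>k=1..n. x k powr l k) = (\<Prod>k=1..n. x k powr l' k) powr (1 - m)"
      by (simp add: l powr_powr prod_powr_distrib)
    also have "\<dots> \<le> (\<Sum>k=1..n. l' k * x k) powr (1 - m)"
      using IH m1 by (intro powr_mono2 prod_nonneg) auto
    finally have "(\<Prod>k=1..Suc n. x k powr l k)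
        \<le> x (Suc n) powr m * (\<Sum>k=1..n. l' k * x k) powr (1 - m)"
      by (simp add: m_def mult.commute mult_left_mono)
    also have "\<dots> \<le> m * x (Suc n) + (1 - m) * (\<Sum>k=1..n. l' k * x k)"
      using step.prems m1
      by (intro bernoulli_imp_young[OF B] sum_nonneg mult_nonneg_nonneg) (auto simp: l'_def less_imp_le)
    also have "\<dots> = (\<Sum>k=1..Suc n. l k * x k)"
      using tail by (simp add: m_def)
    finally show ?case .
  qed
  then show ?thesis unfolding weighted_AM_GM_inequality_def by blast
qed

lemma AM_GM_imp_hoelder:
  assumes AG: weighted_AM_GM_inequality
  shows hoelder_inequality
  unfolding hoelder_inequality_def
proof (intro allI impI)
  fix n :: nat and a b :: "nat \<Rightarrow> real" and p q :: real
  assume a: "\<forall>k\<in>{1..n}. a k \<ge> 0" and b: "\<forall>k\<in>{1..n}. b k \<ge> 0"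
    and p: "p > 1" and q: "q > 1" and pq: "1 / p + 1 / q = 1"
  have young: "u powr (1 / p) * v powr (1 / q) \<le> u / p + v / q" if "u \<ge> 0" "v \<ge> 0" for u v
    using AG[unfolded weighted_AM_GM_inequality_def, rule_format,
        of 2 "\<lambda>k. if k = 1 then u else v" "\<lambda>k. if k = 1 then 1 / p else 1 / q"]
      that p q pq by (simp add: numeral_2_eq_2)
  define A where "A = (\<Sum>k=1..n. a k powr p)"
  define B where "B = (\<Sum>k=1..n. b k powr q)"
  have AB: "A \<ge> 0" "B \<ge> 0" by (auto simp: A_def B_def intro: sum_nonneg)
  have "(\<Sum>k=1..n. a k * b k) \<le> A powr (1 / p) * B powr (1 / q)"
  proof (cases "A = 0 \<or> B = 0")
    case True
    then have "\<forall>k\<in>{1..n}. a k * b k = 0"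
      by (auto simp: A_def B_def sum_nonneg_eq_0_iff)
    then have "(\<Sum>k=1..n. a k * b k) = 0" by (intro sum.neutral)
    then show ?thesis by simp
  next
    case False
    then have AB: "A > 0" "B > 0" using AB by auto
    define C where "C = A powr (1 / p) * B powr (1 / q)"
    have C: "C > 0" using AB by (simp add: C_def)
    have "a k * b k / C \<le> a k powr p / A / p + b k powr q / B / q" if "k \<in> {1..n}" for k
    proof -
      have "(a k powr p / A) powr (1 / p) * (b k powr q / B) powr (1 / q) = a k * b k / C"
        using a b that AB p q by (simp add: powr_divide powr_powr C_def)
      then show ?thesis
        using young[of "a k powr p / A" "b k powr q / B"] AB by simp
    qed
    then have "(\<Sum>k=1..n. a k * b k / C) \<le> (\<Sum>k=1..n. a k powr p / A / p + b k powr q / B / q)"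
      by (rule sum_mono)
    also have "\<dots> = 1"
      using AB pq by (simp add: sum.distrib A_def B_def flip: sum_divide_distrib)
    finally have "(\<Sum>k=1..n. a k * b k) / C \<le> 1" by (simp add: sum_divide_distrib)
    then show ?thesis using C by (simp add: C_def)
  qed
  then show "(\<Sum>k=1..n. a k * b k)
      \<le> (\<Sum>k=1..n. a k powr p) powr (1 / p) * (\<Sum>k=1..n. b k powr q) powr (1 / q)"
    by (simp add: A_def B_def)
qed

lemma hoelder_imp_minkowski:
  assumes H: hoelder_inequality
  shows minkowski_inequality
  unfolding minkowski_inequality_def
proof (intro allI impI)
  fix n :: nat and a b :: "nat \<Rightarrow> real" and p :: real
  assume n: "n \<ge> 1" and a: "\<forall>k\<in>{1..n}. a k \<ge> 0" and b: "\<forall>k\<in>{1..n}. b k \<ge> 0" and "p \<ge> 1"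
  define S where "S = (\<Sum>k=1..n. (a k + b k) powr p)"
  have S: "S \<ge> 0" by (auto simp: S_def intro: sum_nonneg)
  \<comment> \<open>\<open>p = 1\<close> has no conjugate exponent, and the last step divides by a power of \<open>S\<close>\<close>
  consider "p = 1" | "S = 0" | "p > 1" "S > 0" using \<open>p \<ge> 1\<close> S by linarith
  then have "S powr (1 / p)
      \<le> (\<Sum>k=1..n. a k powr p) powr (1 / p) + (\<Sum>k=1..n. b k powr p) powr (1 / p)"
  proof cases
    case 1
    then show ?thesis using a b by (simp add: S_def sum_nonneg sum.distrib)
  next
    case 2
    then show ?thesis by simp
  next
    case 3
    define q where "q = p / (p - 1)"
    have q: "q > 1" "1 / p + 1 / q = 1" "(p - 1) * q = p"
      using 3 by (auto simp: q_def field_simps)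
    \<comment> \<open>the second factor in Hoelder is the same for both parts, as \<open>(p - 1) q = p\<close>\<close>
    have conj_sum: "(\<Sum>k=1..n. ((a k + b k) powr (p - 1)) powr q) = S"
      by (simp add: S_def powr_powr q)
    have hoelder: "(\<Sum>k=1..n. c k * (a k + b k) powr (p - 1))
        \<le> (\<Sum>k=1..n. c k powr p) powr (1 / p) * S powr (1 / q)"
      if "\<forall>k\<in>{1..n}. c k \<ge> 0" for c
      using H[unfolded hoelder_inequality_def, rule_format,
          of n c "\<lambda>k. (a k + b k) powr (p - 1)" p q] n that 3 q
      unfolding conj_sum by simp
    have "S = (\<Sum>k=1..n. a k * (a k + b k) powr (p - 1))
        + (\<Sum>k=1..n. b k * (a k + b k) powr (p - 1))"
      unfolding S_def sum.distrib[symmetric]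
    proof (rule sum.cong)
      fix k assume "k \<in> {1..n}"
      then have "a k + b k \<ge> 0" using a b by simp
      then have "(a k + b k) powr p = (a k + b k) * (a k + b k) powr (p - 1)"
        using 3 by (simp add: powr_mult_base)
      then show "(a k + b k) powr p = a k * (a k + b k) powr (p - 1) + b k * (a k + b k) powr (p - 1)"
        by (simp add: distrib_right)
    qed simp
    also have "\<dots> \<le> ((\<Sum>k=1..n. a k powr p) powr (1 / p)
        + (\<Sum>k=1..n. b k powr p) powr (1 / p)) * S powr (1 / q)"
      using hoelder[OF a] hoelder[OF b] by (simp add: distrib_right)
    finally have "S / S powr (1 / q) \<le> (\<Sum>k=1..n. a k powr p) powr (1 / p)
        + (\<Sum>k=1..n. b k powr p) powr (1 / p)"
      using 3 by (simp add: pos_divide_le_eq)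
    moreover have "S / S powr (1 / q) = S powr (1 - 1 / q)"
      using 3 by (simp add: powr_diff)
    moreover have "1 - 1 / q = 1 / p" using q by simp
    ultimately show ?thesis by simp
  qed
  then show "(\<Sum>k=1..n. (a k + b k) powr p) powr (1 / p)
      \<le> (\<Sum>k=1..n. a k powr p) powr (1 / p) + (\<Sum>k=1..n. b k powr p) powr (1 / p)"
    by (simp add: S_def)
qed

section \<open>From Bernoulli to power means\<close>

text \<open>
  For fixed \<open>c\<close> the left-hand side is linear in \<open>(a, b)\<close>. It is the tangent plane, along the ray
  \<open>a = c b\<close>, of the function on the right, which is homogeneous of degree one.
\<close>

lemma bernoulli_imp_radon_summand:
  fixes a b c m :: real
  assumes B: bernoulli_inequality
    and a: "a \<ge> 0" and b: "b > 0" and c: "c > 0" and m: "m \<ge> 0"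
  shows "(m + 1) * c powr m * a - m * c powr (m + 1) * b \<le> a powr (m + 1) / b powr m"
proof -
  define t where "t = a / (b * c)"
  have t: "t \<ge> 0" using a b c by (simp add: t_def)
  have "1 + (m + 1) * (t - 1) \<le> t powr (m + 1)"
    using B[unfolded bernoulli_inequality_def, rule_format, of "t - 1" "m + 1"] t m by simp
  then have "b * c powr (m + 1) * (1 + (m + 1) * (t - 1)) \<le> b * c powr (m + 1) * t powr (m + 1)"
    using b by (intro mult_left_mono) simp_all
  moreover have "b * c powr (m + 1) * (1 + (m + 1) * (t - 1))
      = (m + 1) * c powr m * a - m * c powr (m + 1) * b"
    using b c by (simp add: t_def powr_add field_simps)
  moreover have "b * c powr (m + 1) * t powr (m + 1) = a powr (m + 1) / b powr m"
    using a b c by (simp add: t_def powr_divide powr_mult powr_add)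
  ultimately show ?thesis by simp
qed

lemma bernoulli_imp_radon:
  assumes B: bernoulli_inequality
  shows radon_inequality
  unfolding radon_inequality_def
proof (intro allI impI)
  fix n :: nat and a b :: "nat \<Rightarrow> real" and m :: real
  assume n: "n \<ge> 1" and b: "\<forall>k\<in>{1..n}. b k > 0" and a: "\<forall>k\<in>{1..n}. a k \<ge> 0" and m: "m \<ge> 0"
  define S where "S = (\<Sum>k=1..n. a k)"
  define T where "T = (\<Sum>k=1..n. b k)"
  have T: "T > 0" unfolding T_def using n b by (intro sum_pos) auto
  have S: "S \<ge> 0" unfolding S_def using a by (intro sum_nonneg) auto
  have "S powr (m + 1) / T powr m \<le> (\<Sum>k=1..n. a k powr (m + 1) / b k powr m)"
  proof (cases "S = 0")
    case True
    then show ?thesis by (simp add: sum_nonneg)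
  next
    case False
    define c where "c = S / T"
    have c: "c > 0" using False S T by (simp add: c_def)
    have "S powr (m + 1) / T powr m = (m + 1) * c powr m * S - m * c powr (m + 1) * T"
      using False S T by (simp add: c_def powr_add powr_divide field_simps)
    also have "\<dots> = (\<Sum>k=1..n. (m + 1) * c powr m * a k - m * c powr (m + 1) * b k)"
      by (simp add: S_def T_def sum_subtractf sum_distrib_left)
    also have "\<dots> \<le> (\<Sum>k=1..n. a k powr (m + 1) / b k powr m)"
      using a b c m by (intro sum_mono bernoulli_imp_radon_summand[OF B]) auto
    finally show ?thesis .
  qed
  then show "(\<Sum>k=1..n. a k) powr (m + 1) / (\<Sum>k=1..n. b k) powr m
      \<le> (\<Sum>k=1..n. a k powr (m + 1) / b k powr m)"
    by (simp add: S_def T_def)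
qed

lemma radon_imp_power_mean:
  assumes R: radon_inequality
  shows weighted_power_mean_inequality
  unfolding weighted_power_mean_inequality_def
proof (intro allI impI)
  fix n :: nat and x p :: "nat \<Rightarrow> real" and r s :: real
  assume n: "n \<ge> 1" and x: "\<forall>k\<in>{1..n}. x k \<ge> 0" and p: "\<forall>k\<in>{1..n}. p k > 0"
    and rs: "r \<ge> s" and s: "s > 0"
  define T where "T = (\<Sum>k=1..n. p k)"
  define X where "X = (\<Sum>k=1..n. p k * x k powr s)"
  define Y where "Y = (\<Sum>k=1..n. p k * x k powr r)"
  have T: "T > 0" unfolding T_def using n p by (intro sum_pos) auto
  have X: "X \<ge> 0" unfolding X_def using p by (intro sum_nonneg) (simp add: less_imp_le)
  define m where "m = r / s - 1"
  have m: "m \<ge> 0" "m + 1 = r / s" using rs s by (auto simp: m_def)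
  have "(p k * x k powr s) powr (m + 1) / p k powr m = p k * x k powr r"
    if "k \<in> {1..n}" for k
  proof -
    have "p k > 0" using p that by blast
    moreover have "(p k * x k powr s) powr (m + 1) = p k powr (m + 1) * x k powr r"
      using s \<open>p k > 0\<close> by (simp add: powr_mult powr_powr m(2))
    ultimately show ?thesis
      unfolding \<open>(p k * x k powr s) powr (m + 1) = _\<close> by (simp add: powr_add)
  qed
  then have "X powr (m + 1) / T powr m \<le> Y"
    using R[unfolded radon_inequality_def, rule_format, of n p "\<lambda>k. p k * x k powr s" m] n p m(1)
    by (simp add: X_def Y_def T_def less_imp_le)
  then have "X powr (m + 1) / T powr m / T \<le> Y / T"
    using T by (intro divide_right_mono) simp_all
  moreover have "X powr (m + 1) / T powr m / T = (X / T) powr (r / s)"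
    using X T by (simp add: powr_divide powr_add flip: m(2))
  ultimately have "((X / T) powr (r / s)) powr (1 / r) \<le> (Y / T) powr (1 / r)"
    using rs s by (intro powr_mono2) auto
  then show "((\<Sum>k=1..n. p k * x k powr r) / (\<Sum>k=1..n. p k)) powr (1 / r)
      \<ge> ((\<Sum>k=1..n. p k * x k powr s) / (\<Sum>k=1..n. p k)) powr (1 / s)"
    using rs s by (simp add: powr_powr X_def Y_def T_def)
qed

section \<open>Back to Bernoulli\<close>

lemma DERIV_le_of_touching_below:
  fixes f g :: "real \<Rightarrow> real"
  assumes f: "(f has_real_derivative D) (at 0)" and g: "(g has_real_derivative E) (at 0)"
    and "f 0 = g 0" and le: "\<And>t. 0 < t \<Longrightarrow> t < 1 \<Longrightarrow> f t \<le> g t"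
  shows "D \<le> E"
proof (rule ccontr)
  assume "\<not> D \<le> E"
  then have "D - E > 0" by simp
  moreover have "((\<lambda>t. f t - g t) has_real_derivative D - E) (at 0)"
    using f g by (rule DERIV_diff)
  ultimately obtain d where d: "d > 0"
    "\<And>h. 0 < h \<Longrightarrow> h < d \<Longrightarrow> f 0 - g 0 < f (0 + h) - g (0 + h)"
    using DERIV_pos_inc_right by blast
  define h where "h = min d 1 / 2"
  have "0 < h" "h < d" "h < 1" using d(1) by (auto simp: h_def)
  then show False using d(2)[of h] le[of h] assms(3) by simp
qed

lemma DERIV_one_plus_mult_powr:
  fixes c p :: real
  shows "((\<lambda>t. (1 + t * c) powr p) has_real_derivative p * c) (at 0)"
  by (auto intro!: derivative_eq_intros)

lemma powr_convex_imp_bernoulli: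
  assumes conv: "\<And>p c t :: real. p \<ge> 1 \<Longrightarrow> c \<ge> 0 \<Longrightarrow> 0 < t \<Longrightarrow> t < 1 \<Longrightarrow>
    ((1 - t) + t * c) powr p \<le> (1 - t) + t * c powr p"
  shows bernoulli_inequality
  unfolding bernoulli_inequality_def
proof (intro allI impI)
  fix x p :: real
  assume x: "x \<ge> -1" and p: "p \<ge> 1"
  have "p * x \<le> (1 + x) powr p - 1"
  proof (rule DERIV_le_of_touching_below)
    show "((\<lambda>t. (1 + t * x) powr p) has_real_derivative p * x) (at 0)"
      by (rule DERIV_one_plus_mult_powr)
    show "((\<lambda>t. (1 - t) + t * (1 + x) powr p) has_real_derivative (1 + x) powr p - 1) (at 0)"
      by (auto intro!: derivative_eq_intros)
    show "(1 + t * x) powr p \<le> (1 - t) + t * (1 + x) powr p" if "0 < t" "t < 1" for t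
      using conv[of p "1 + x" t] x p that by (simp add: algebra_simps)
  qed simp
  then show "(1 + x) powr p \<ge> 1 + p * x" by simp
qed

lemma power_mean_imp_bernoulli:
  assumes M: weighted_power_mean_inequality
  shows bernoulli_inequality
proof (rule powr_convex_imp_bernoulli)
  fix p c t :: real
  assume p: "p \<ge> 1" and c: "c \<ge> 0" and t: "0 < t" "t < 1"
  define M where "M = (1 - t) + t * c powr p"
  have M0: "M \<ge> 0" "(1 - t) + t * c \<ge> 0" using c t by (auto simp: M_def)
  have "(1 - t) + t * c \<le> M powr (1 / p)"
    using assms[unfolded weighted_power_mean_inequality_def, rule_format,
        of 2 "\<lambda>k. if k = 1 then 1 else c" "\<lambda>k. if k = 1 then 1 - t else t" 1 p] p c t M0
    by (simp add: numeral_2_eq_2 M_def)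
  then have "((1 - t) + t * c) powr p \<le> (M powr (1 / p)) powr p"
    using M0 p by (intro powr_mono2) auto
  then show "((1 - t) + t * c) powr p \<le> (1 - t) + t * c powr p"
    using M0 p by (simp add: powr_powr M_def)
qed

text \<open>
  With \<open>h\<^sup>p = d\<close>, Minkowski for the two vectors \<open>(1 - t) (1, h)\<close> and \<open>t (1, h c)\<close> in the plane reads
  \<open>(1 + d w\<^sup>p)\<^sup>1\<^sup>/\<^sup>p \<le> (1 - t) (1 + d)\<^sup>1\<^sup>/\<^sup>p + t (1 + d c\<^sup>p)\<^sup>1\<^sup>/\<^sup>p\<close>, where \<open>w = (1 - t) + t c\<close>. Equality
  holds at \<open>d = 0\<close>, and \<open>p\<close> times the derivatives there are the two sides of the convexity inequality.
\<close>

lemma minkowski_imp_bernoulli: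
  assumes M: minkowski_inequality
  shows bernoulli_inequality
proof (rule powr_convex_imp_bernoulli)
  fix p c t :: real
  assume p: "p \<ge> 1" and c: "c \<ge> 0" and t: "0 < t" "t < 1"
  define w where "w = (1 - t) + t * c"
  have w: "w \<ge> 0" using c t by (simp add: w_def)
  have "1 / p * w powr p \<le> (1 - t) * (1 / p * 1) + t * (1 / p * c powr p)"
  proof (rule DERIV_le_of_touching_below)
    show "((\<lambda>d. (1 + d * w powr p) powr (1 / p)) has_real_derivative 1 / p * w powr p) (at 0)"
      by (rule DERIV_one_plus_mult_powr)
    show "((\<lambda>d. (1 - t) * (1 + d * 1) powr (1 / p) + t * (1 + d * c powr p) powr (1 / p))
        has_real_derivative (1 - t) * (1 / p * 1) + t * (1 / p * c powr p)) (at 0)"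
      by (intro DERIV_add DERIV_cmult DERIV_one_plus_mult_powr)
    show "(1 + d * w powr p) powr (1 / p)
        \<le> (1 - t) * (1 + d * 1) powr (1 / p) + t * (1 + d * c powr p) powr (1 / p)"
      if d: "0 < d" "d < 1" for d
    proof -
      define h where "h = d powr (1 / p)"
      have h: "h \<ge> 0" "h powr p = d" using d p by (auto simp: h_def powr_powr)
      have scale: "(s powr p + (s * (h * y)) powr p) powr (1 / p)
          = s * (1 + d * y powr p) powr (1 / p)" if "s \<ge> 0" "y \<ge> 0" for s y
      proof -
        have "s powr p + (s * (h * y)) powr p = s powr p * (1 + d * y powr p)"
          using that h by (simp add: powr_mult algebra_simps)
        then show ?thesis using that p d by (simp add: powr_mult powr_powr)
      qed
      have "((1 - t + t) powr p + ((1 - t) * (h * 1) + t * (h * c)) powr p) powr (1 / p)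
          \<le> ((1 - t) powr p + ((1 - t) * (h * 1)) powr p) powr (1 / p)
            + (t powr p + (t * (h * c)) powr p) powr (1 / p)"
        using M[unfolded minkowski_inequality_def, rule_format,
            of 2 "\<lambda>k. if k = 1 then 1 - t else (1 - t) * (h * 1)"
              "\<lambda>k. if k = 1 then t else t * (h * c)" p] p c t h
        by (simp add: numeral_2_eq_2)
      moreover have "(1 - t) * (h * 1) + t * (h * c) = 1 * (h * w)"
        by (simp add: w_def algebra_simps)
      ultimately show ?thesis
        using scale[of 1 w] scale[of "1 - t" 1] scale[of t c] w c t by simp
    qed
  qed simp
  moreover have "(1 - t) * (1 / p * 1) + t * (1 / p * c powr p)
      = 1 / p * ((1 - t) + t * c powr p)"
    using p by (simp add: field_simps)
  ultimately show "((1 - t) + t * c) powr p \<le> (1 - t) + t * c powr p"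
    using p by (simp add: w_def divide_le_cancel)
qed

theorem theorem2p3:
  "equivalent_assertions
    [bernoulli_inequality,
     weighted_AM_GM_inequality,
     hoelder_inequality,
     weighted_power_mean_inequality,
     minkowski_inequality,
     radon_inequality]"
proof -
  have "weighted_AM_GM_inequality = bernoulli_inequality"
    "hoelder_inequality = bernoulli_inequality"
    "weighted_power_mean_inequality = bernoulli_inequality"
    "minkowski_inequality = bernoulli_inequality"
    "radon_inequality = bernoulli_inequality"
    using bernoulli_imp_AM_GM AM_GM_imp_hoelder hoelder_imp_minkowski minkowski_imp_bernoulli
      bernoulli_imp_radon radon_imp_power_mean power_mean_imp_bernoulli by blast+
  then show ?thesis
    by (auto simp: equivalent_assertions_def less_Suc_eq_0_disj)
qed

end
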